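(* Let $G$ be a first countable Hausdorff topological group, let $H$ be a dense countable subgroup of $G$, let $(X,d)$ be a compact metric space, and let $\Phi\in\operatorname{Act}(G,X)$. Then the set $P(\Phi)$ of all $\beta$-persistent points of $\Phi$ is an $F_{\sigma\delta}$-subset of $X$ (a countable intersection of countable unions of closed sets), and hence it is (Borel) measurable.
   Context: $\operatorname{Act}(G,X)$ denotes the set of all continuous maps $\Phi:G\times X\to X$ such that, writing $\Phi_g=\Phi(g,\cdot)$, each $\Phi_g$ is a homeomorphism of $X$, $\Phi_e=\mathrm{id}_X$ for the identity $e\in G$, and $\Phi_g\circ\Phi_h=\Phi_{gh}$ for all $g,h\in G$. For $\Phi,\Psi\in\operatorname{Act}(G,X)$ put $d_H(\Phi,\Psi)=\sup_{h\in H,\,x\in X} d(\Phi_h(x),\Psi_h(x))$. A point $x\in X$ is a $\beta$-persistent point of $\Phi$ (with respect to $H$) if for each $\epsilon>0$ there is $\delta>0$ such that for each $\Psi\in\operatorname{Act}(G,X)$ with $d_H(\Phi,\Psi)\le\delta$ there is $y\in X$ with $d(\Phi_g(x),\Psi_g(y))\le\epsilon$ for each $g\in G$. $P(\Phi)$ is the set of all $\beta$-persistent points of $\Phi$. *)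

theory Defs
  imports "HOL-Analysis.Analysis"
begin

text \<open>
  The group is written additively, because the topological groups of the library are the type
  class \<open>topological_group_add\<close>. That class does not assume commutativity; \<open>0\<close> is the identity
  element and \<open>g + h\<close> the product of \<open>g\<close> and \<open>h\<close>. The space \<open>X\<close> is a whole type of class
  \<open>metric_space\<close>; its compactness is assumed separately.
\<close>

definition is_subgroup :: "'g::group_add set \<Rightarrow> bool" where
  "is_subgroup H \<longleftrightarrow> 0 \<in> H \<and> (\<forall>g\<in>H. \<forall>h\<in>H. g + h \<in> H) \<and> (\<forall>g\<in>H. - g \<in> H)"

definition Act :: "('g::topological_group_add \<times> 'x::topological_space \<Rightarrow> 'x) set" where
  "Act = {\<Phi>. continuous_on UNIV \<Phi> \<and>
     (\<forall>g. \<exists>k. homeomorphism UNIV UNIV (\<lambda>x. \<Phi> (g, x)) k) \<and>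
     (\<lambda>x. \<Phi> (0, x)) = id \<and>
     (\<forall>g h. (\<lambda>x. \<Phi> (g, x)) \<circ> (\<lambda>x. \<Phi> (h, x)) = (\<lambda>x. \<Phi> (g + h, x)))}"

text \<open>
  The supremum is a real supremum. It is meaningful for nonempty \<open>H\<close> and bounded \<open>X\<close>, in particular
  for a subgroup \<open>H\<close> and a compact \<open>X\<close>.
\<close>

definition act_dist ::
  "'g set \<Rightarrow> ('g \<times> 'x::metric_space \<Rightarrow> 'x) \<Rightarrow> ('g \<times> 'x \<Rightarrow> 'x) \<Rightarrow> real" where
  "act_dist H \<Phi> \<Psi> = (SUP (h, x) \<in> H \<times> UNIV. dist (\<Phi> (h, x)) (\<Psi> (h, x)))"

definition beta_persistent_point ::
  "'g::topological_group_add set \<Rightarrow> ('g \<times> 'x::metric_space \<Rightarrow> 'x) \<Rightarrow> 'x \<Rightarrow> bool" where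
  "beta_persistent_point H \<Phi> x \<longleftrightarrow>
     (\<forall>\<epsilon>>0. \<exists>\<delta>>0. \<forall>\<Psi>\<in>Act. act_dist H \<Phi> \<Psi> \<le> \<delta> \<longrightarrow>
        (\<exists>y. \<forall>g. dist (\<Phi> (g, x)) (\<Psi> (g, y)) \<le> \<epsilon>))"

definition beta_persistent_points ::
  "'g::topological_group_add set \<Rightarrow> ('g \<times> 'x::metric_space \<Rightarrow> 'x) \<Rightarrow> 'x set" where
  "beta_persistent_points H \<Phi> = {x. beta_persistent_point H \<Phi> x}"

definition fsigmadelta :: "'a::topological_space set \<Rightarrow> bool" where
  "fsigmadelta = countable intersection_of fsigma"

end

theory Submission
  imports Defs
begin

text \<open>
  For fixed \<open>\<epsilon>\<close> and \<open>\<Psi>\<close> the points whose \<open>\<Phi>\<close>-orbit is \<open>\<epsilon>\<close>-shadowed by a \<open>\<Psi>\<close>-orbit form the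
  projection of a closed subset of the compact space \<open>X \<times> X\<close>, hence a closed set. Intersecting
  over all \<open>\<Psi>\<close> within distance \<open>\<delta>\<close> of \<open>\<Phi>\<close> keeps closedness. Both quantifiers over \<open>\<epsilon>\<close> and \<open>\<delta>\<close>
  are monotone, so they can be restricted to the values \<open>1 / (n + 1)\<close>.
\<close>

lemma closed_shadowed:
  fixes \<Phi> \<Psi> :: "'g \<times> 'x::metric_space \<Rightarrow> 'x"
  assumes "compact (UNIV :: 'x set)"
    and "\<And>g. continuous_on UNIV (\<lambda>x. \<Phi> (g, x))"
    and "\<And>g. continuous_on UNIV (\<lambda>x. \<Psi> (g, x))"
  shows "closed {x. \<exists>y. \<forall>g. dist (\<Phi> (g, x)) (\<Psi> (g, y)) \<le> \<epsilon>}"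
proof -
  define K where "K = {p. \<forall>g. dist (\<Phi> (g, fst p)) (\<Psi> (g, snd p)) \<le> \<epsilon>}"
  have "continuous_on UNIV (\<lambda>p. \<Phi> (g, fst p))" "continuous_on UNIV (\<lambda>p. \<Psi> (g, snd p))" for g
    using continuous_on_compose2[OF assms(2) continuous_on_fst[OF continuous_on_id]]
      continuous_on_compose2[OF assms(3) continuous_on_snd[OF continuous_on_id]] by auto
  then have "closed K"
    unfolding K_def
    by (intro closed_Collect_all closed_Collect_le continuous_on_dist continuous_on_const)
  moreover have "compact (UNIV :: ('x \<times> 'x) set)"
    using compact_Times[OF assms(1) assms(1)] by simp
  ultimately have "compact K"
    using compact_Int_closed by fastforce
  \<comment> \<open>The projection of a closed set need not be closed. That of a compact set is
    compact, hence closed in a metric space.\<close>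
  then have "compact (fst ` K)"
    by (intro compact_continuous_image continuous_on_fst continuous_on_id)
  moreover have "fst ` K = {x. \<exists>y. \<forall>g. dist (\<Phi> (g, x)) (\<Psi> (g, y)) \<le> \<epsilon>}"
    by (auto simp: K_def image_iff) blast
  ultimately show ?thesis
    using compact_imp_closed by simp
qed

lemma Act_continuous:
  assumes "\<Phi> \<in> Act"
  shows "continuous_on UNIV (\<lambda>x. \<Phi> (g, x))"
  using assms by (auto simp: Act_def homeomorphism_def)

lemma fsigmadelta_INT_UN:
  assumes "\<And>n m::nat. closed (A n m)"
  shows "fsigmadelta (\<Inter>n::nat. \<Union>m. A n m)"
proof -
  have "fsigma (\<Union>m. A n m)" for n
    using assms by (rule fsigma.intros)
  then show ?thesis
    unfolding fsigmadelta_def intersection_of_def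
    by (intro exI[of _ "range (\<lambda>n. \<Union>m. A n m)"]) auto
qed

lemma fsigmadelta_imp_borel:
  assumes "fsigmadelta S"
  shows "S \<in> sets borel"
proof -
  obtain \<U> where \<U>: "countable \<U>" "\<U> \<subseteq> Collect fsigma" "\<Inter>\<U> = S"
    using assms by (auto simp: fsigmadelta_def intersection_of_def)
  have "T \<in> sets borel" if "fsigma T" for T :: "'a set"
    using that by cases auto
  with \<U>(2) have "\<And>T. T \<in> \<U> \<Longrightarrow> T \<in> sets borel"
    by auto
  \<comment> \<open>The family \<open>\<U>\<close> may be empty, with intersection the whole space;
    \<open>sets.countable_INT''\<close> covers this case because \<open>UNIV\<close> is a Borel
    set.\<close>
  then have "(\<Inter>T\<in>\<U>. T) \<in> sets borel"
    by (intro sets.countable_INT'' \<U>(1)) auto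
  with \<U>(3) show ?thesis
    by simp
qed

text \<open>By the Archimedean property some \<open>inverse (real (Suc n))\<close> lies below a
  given positive \<open>\<delta>\<close>, and \<open>P\<close> passes down to it.\<close>

lemma ex_inverse_Suc_iff:
  fixes P :: "real \<Rightarrow> bool"
  assumes "\<And>a b. \<lbrakk>0 < a; a \<le> b; P b\<rbrakk> \<Longrightarrow> P a"
  shows "(\<exists>\<delta>>0. P \<delta>) \<longleftrightarrow> (\<exists>n. P (inverse (real (Suc n))))"
  by (metis assms inverse_positive_iff_positive less_imp_le of_nat_0_less_iff
      reals_Archimedean zero_less_Suc)

theorem theorem3p10:
  fixes H :: "'g::{topological_group_add, first_countable_topology, t2_space} set"
    and \<Phi> :: "'g \<times> 'x::metric_space \<Rightarrow> 'x"
  assumes "is_subgroup H" and "countable H" and "closure H = UNIV"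
    and "compact (UNIV :: 'x set)"
    and "\<Phi> \<in> Act"
  shows "fsigmadelta (beta_persistent_points H \<Phi>) \<and>
         beta_persistent_points H \<Phi> \<in> sets borel"
proof -
  define P where "P x \<epsilon> \<delta> \<longleftrightarrow> (\<forall>\<Psi>\<in>Act. act_dist H \<Phi> \<Psi> \<le> \<delta> \<longrightarrow>
    (\<exists>y. \<forall>g. dist (\<Phi> (g, x)) (\<Psi> (g, y)) \<le> \<epsilon>))" for x \<epsilon> \<delta>
  have P_mono: "P x \<epsilon>' \<delta>'" if "P x \<epsilon> \<delta>" "\<epsilon> \<le> \<epsilon>'" "\<delta>' \<le> \<delta>" for x \<epsilon> \<delta> \<epsilon>' \<delta>'
    using that unfolding P_def by (meson order_trans)
  let ?r = "\<lambda>n. inverse (real (Suc n))"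
  have closed_P: "closed {x. P x \<epsilon> \<delta>}" for \<epsilon> \<delta>
  proof -
    have "{x. P x \<epsilon> \<delta>} = (\<Inter>\<Psi>\<in>{\<Psi>\<in>Act. act_dist H \<Phi> \<Psi> \<le> \<delta>}.
        {x. \<exists>y. \<forall>g. dist (\<Phi> (g, x)) (\<Psi> (g, y)) \<le> \<epsilon>})"
      by (auto simp: P_def)
    also have "closed \<dots>"
      using assms(4,5) by (intro closed_INT ballI closed_shadowed Act_continuous) auto
    finally show ?thesis .
  qed
  have "beta_persistent_point H \<Phi> x \<longleftrightarrow> (\<forall>n. \<exists>m. P x (?r n) (?r m))" for x
  proof -
    \<comment> \<open>The quantifier over \<open>\<epsilon>\<close> becomes a negated existential
      because \<open>P\<close> is preserved when \<open>\<epsilon>\<close> grows: failure is then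
      inherited by smaller \<open>\<epsilon>\<close>, which is the direction that
      \<open>ex_inverse_Suc_iff\<close> asks for. For \<open>\<delta>\<close> the lemma applies
      directly.\<close>
    have "beta_persistent_point H \<Phi> x \<longleftrightarrow> \<not> (\<exists>\<epsilon>>0. \<not> (\<exists>\<delta>>0. P x \<epsilon> \<delta>))"
      unfolding beta_persistent_point_def P_def by blast
    also have "\<dots> \<longleftrightarrow> (\<forall>n. \<exists>\<delta>>0. P x (?r n) \<delta>)"
      by (subst ex_inverse_Suc_iff) (use P_mono in blast)+
    also have "\<dots> \<longleftrightarrow> (\<forall>n. \<exists>m. P x (?r n) (?r m))"
      by (subst ex_inverse_Suc_iff) (use P_mono in blast)+
    finally show ?thesis .
  qed
  then have "beta_persistent_points H \<Phi> = (\<Inter>n. \<Union>m. {x. P x (?r n) (?r m)})"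
    by (auto simp: beta_persistent_points_def)
  with closed_P have "fsigmadelta (beta_persistent_points H \<Phi>)"
    by (simp only: fsigmadelta_INT_UN)
  then show ?thesis
    using fsigmadelta_imp_borel by blast
qed

end
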